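(* For nonnegative integers $m,n$ with $(m,n)\neq(0,0)$, let $U_{m,n}$ be a configuration of $m$ points on the positive real axis and $n$ points on the positive imaginary axis of $\mathbb{C}$, let $u_{m,n}=|\textsc{NC}(U_{m,n})|$, and set $u_{0,0}=0$. Then \[\sum_{m,n\ge 0}u_{m,n}x^my^n=\frac{x+y-2xy}{1-2x-2y+3xy}.\]
   Context: For a finite set $P\subset\mathbb{C}$, a partition of $P$ is noncrossing if the convex hulls of its blocks are pairwise disjoint; $\textsc{NC}(P)$ is the set of noncrossing partitions of $P$. Its cardinality depends only on $m$ and $n$ for the configurations above. The value $u_{0,0}=0$ is the paper's convention for the empty configuration. *)

theory Defs
  imports "HOL-Analysis.Analysis" "HOL-Computational_Algebra.Formal_Power_Series"
    "HOL-Library.Disjoint_Sets"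
begin

definition pos_real_axis :: "complex set" where
  "pos_real_axis = {z. 0 < Re z \<and> Im z = 0}"

definition pos_imag_axis :: "complex set" where
  "pos_imag_axis = {z. Re z = 0 \<and> 0 < Im z}"

text \<open>The two half-axes are disjoint (both exclude the origin), so such a set has
  \<open>m + n\<close> points.\<close>

definition axis_configuration :: "nat \<Rightarrow> nat \<Rightarrow> complex set \<Rightarrow> bool" where
  "axis_configuration m n P \<longleftrightarrow>
     finite P \<and> P \<subseteq> pos_real_axis \<union> pos_imag_axis \<and>
     card (P \<inter> pos_real_axis) = m \<and> card (P \<inter> pos_imag_axis) = n"

definition NC :: "complex set \<Rightarrow> complex set set set" where
  "NC P = {\<pi>. partition_on P \<pi> \<and> disjoint_family_on (\<lambda>B. convex hull B) \<pi>}"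

text \<open>The case distinction is the convention that the empty configuration contributes \<open>0\<close>;
  the empty set has exactly one partition, so \<open>card (NC {})\<close> would be \<open>1\<close>.\<close>

definition nc_count :: "(nat \<Rightarrow> nat \<Rightarrow> complex set) \<Rightarrow> nat \<Rightarrow> nat \<Rightarrow> nat" where
  "nc_count U m n = (if m = 0 \<and> n = 0 then 0 else card (NC (U m n)))"

text \<open>Formal power series in two variables are series in \<open>x\<close> whose coefficients are series
  in \<open>y\<close>.\<close>

abbreviation fps_x :: "rat fps fps" where
  "fps_x \<equiv> fps_X"

abbreviation fps_y :: "rat fps fps" where
  "fps_y \<equiv> fps_const fps_X"

definition bivariate_gf :: "(nat \<Rightarrow> nat \<Rightarrow> nat) \<Rightarrow> rat fps fps" where
  "bivariate_gf u = Abs_fps (\<lambda>m. Abs_fps (\<lambda>n. of_nat (u m n)))"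

lemma coeff_monomial:
  "fps_nth (fps_nth (fps_const (fps_const c) * fps_x ^ m * fps_y ^ n) i) j
     = (if i = m \<and> j = n then c else 0)"
proof -
  have "fps_const (fps_const c) * fps_x ^ m * fps_y ^ n
          = fps_const (fps_const c * fps_X ^ n) * fps_X ^ m"
    by (simp add: fps_const_power mult.commute mult.left_commute flip: fps_const_mult)
  then show ?thesis
    by (simp add: fps_X_power_iff)
qed

text \<open>The coefficient ring \<open>rat fps\<close> is not a field, so not every division in \<open>rat fps fps\<close>
  is meaningful. Here the denominator is a unit and the quotient is the genuine one.\<close>

lemma quotient_is_genuine:
  fixes f :: "rat fps fps"
  defines "d \<equiv> 1 - 2 * fps_x - 2 * fps_y + 3 * fps_x * fps_y"
  shows "f / d * d = f"
proof -
  have d0: "fps_nth d 0 = 1 - 2 * fps_X"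
    by (simp add: d_def mult.assoc numeral_fps_const)
  have "fps_nth (1 - 2 * fps_X :: rat fps) 0 \<noteq> 0"
    by simp
  then have inv0: "fps_nth d 0 * inverse (fps_nth d 0) = 1"
    unfolding d0 by (rule inverse_mult_eq_1')
  then have "fps_nth d 0 \<noteq> 0"
    by auto
  then have "subdegree d = 0"
    by simp
  then have "f / d = f * inverse d"
    by (simp add: fps_divide_def)
  moreover have "d * inverse d = 1"
    using fps_right_inverse[OF inv0] by (simp add: fps_inverse_def)
  ultimately show ?thesis
    by (simp add: mult.assoc mult.commute[of _ d])
qed

end

theory Submission
  imports Defs
begin

text \<open>Let \<open>p\<close> and \<open>q\<close> be the outermost points on the two axes. In a noncrossing partition \<open>p\<close> is a
  singleton block, or shares its block with the preceding point of its axis, or is the only point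
  of its axis in a mixed block. Removing \<open>p\<close> puts each of the first two classes in bijection with the
  noncrossing partitions of the remaining points, and similarly for \<open>q\<close>. If both \<open>p\<close> and \<open>q\<close> are in
  the third class, then \<open>{p, q}\<close> is a block. Inclusion-exclusion therefore gives
  \<open>u m n = 2 u (m - 1) n + 2 u m (n - 1) - 4 u (m - 1) (n - 1) + u (m - 1) (n - 1)\<close>, where for an
  axis with a single point the factor \<open>2\<close> becomes \<open>1\<close>.\<close>

section \<open>Order on the points of the two half-axes\<close>

abbreviation axes :: "complex set" where
  "axes \<equiv> pos_real_axis \<union> pos_imag_axis"

definition coaxial :: "complex \<Rightarrow> complex \<Rightarrow> bool" where
  "coaxial z w \<longleftrightarrow> {z, w} \<subseteq> pos_real_axis \<or> {z, w} \<subseteq> pos_imag_axis"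

text \<open>Two blocks have disjoint hulls iff one of them is below the other in the following sense:
  such blocks are separated by a line \<open>X / s + Y / t = 1\<close> with \<open>s, t > 0\<close>.\<close>

definition below :: "complex set \<Rightarrow> complex set \<Rightarrow> bool" where
  "below B C \<longleftrightarrow> (\<forall>b\<in>B. \<forall>c\<in>C. coaxial b c \<longrightarrow> cmod b < cmod c)"

lemma coaxial_sym: "coaxial z w \<Longrightarrow> coaxial w z"
  by (auto simp: coaxial_def)

text \<open>The half-axes exclude the origin, so no common point \<open>w\<close> can link a real
  point to an imaginary one.\<close>

lemma coaxial_trans: "coaxial z w \<Longrightarrow> coaxial w v \<Longrightarrow> coaxial z v"
  by (auto simp: coaxial_def pos_real_axis_def pos_imag_axis_def)

lemma coaxial_refl: "z \<in> axes \<Longrightarrow> coaxial z z"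
  by (auto simp: coaxial_def)

lemma cmod_pos_real_axis: "z \<in> pos_real_axis \<Longrightarrow> cmod z = Re z"
  by (simp add: pos_real_axis_def cmod_eq_Re)

lemma cmod_pos_imag_axis: "z \<in> pos_imag_axis \<Longrightarrow> cmod z = Im z"
  by (simp add: pos_imag_axis_def cmod_eq_Im)

lemma coaxial_cmod_inj: "coaxial z w \<Longrightarrow> cmod z = cmod w \<Longrightarrow> z = w"
  using cmod_pos_real_axis[of z] cmod_pos_real_axis[of w]
    cmod_pos_imag_axis[of z] cmod_pos_imag_axis[of w]
  by (auto simp: coaxial_def pos_real_axis_def pos_imag_axis_def complex_eq_iff)

section \<open>Disjointness of convex hulls\<close>

text \<open>Supplies the intercepts \<open>s\<close> and \<open>t\<close> of the separating line.
  They become divisors and must be positive, so an empty \<open>X\<close>, which has no maximum, is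
  treated separately.\<close>

lemma finite_sets_separated:
  fixes X Y :: "real set"
  assumes "finite X" "finite Y" "\<And>y. y \<in> Y \<Longrightarrow> 0 < y" "\<And>x. x \<in> X \<Longrightarrow> 0 < x"
    and "\<And>x y. x \<in> X \<Longrightarrow> y \<in> Y \<Longrightarrow> x < y"
  obtains d where "0 < d" "\<And>x. x \<in> X \<Longrightarrow> x \<le> d" "\<And>y. y \<in> Y \<Longrightarrow> d < y"
proof (cases "X = {}")
  case False
  then show ?thesis
    using assms that[of "Max X"] by simp
next
  case X: True
  show ?thesis
  proof (cases "Y = {}")
    case True
    then show ?thesis using X that[of 1] by simp
  next
    case False
    then have "Min Y \<in> Y" using assms by simp
    then have pos: "0 < Min Y" using assms by blast
    have "Min Y / 2 < y" if "y \<in> Y" for y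
    proof -
      have "Min Y \<le> y" using that assms(2) by simp
      then show ?thesis using pos by linarith
    qed
    then show ?thesis using X pos that[of "Min Y / 2"] by simp
  qed
qed

lemma below_imp_hulls_disjoint:
  assumes fin: "finite B" "finite C" and ax: "B \<subseteq> axes" "C \<subseteq> axes" and "below B C"
  shows "convex hull B \<inter> convex hull C = {}"
proof -
  obtain s where s: "0 < s" "\<And>x. x \<in> cmod ` (B \<inter> pos_real_axis) \<Longrightarrow> x \<le> s"
      "\<And>x. x \<in> cmod ` (C \<inter> pos_real_axis) \<Longrightarrow> s < x"
  proof (rule finite_sets_separated)
    fix x y
    assume "x \<in> cmod ` (B \<inter> pos_real_axis)" "y \<in> cmod ` (C \<inter> pos_real_axis)"
    then show "x < y"
      using \<open>below B C\<close> by (auto simp: below_def coaxial_def)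
  qed (use fin in \<open>auto simp: pos_real_axis_def\<close>)
  obtain t where t: "0 < t" "\<And>x. x \<in> cmod ` (B \<inter> pos_imag_axis) \<Longrightarrow> x \<le> t"
      "\<And>x. x \<in> cmod ` (C \<inter> pos_imag_axis) \<Longrightarrow> t < x"
  proof (rule finite_sets_separated)
    fix x y
    assume "x \<in> cmod ` (B \<inter> pos_imag_axis)" "y \<in> cmod ` (C \<inter> pos_imag_axis)"
    then show "x < y"
      using \<open>below B C\<close> by (auto simp: below_def coaxial_def)
  qed (use fin in \<open>auto simp: pos_imag_axis_def\<close>)
  \<comment> \<open>Normal vector of the line \<open>X / s + Y / t = 1\<close>: \<open>B\<close>
    falls into the closed half-plane below it and \<open>C\<close> into the open one above
    it.\<close>
  define n where "n = Complex (1 / s) (1 / t)"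
  have n_real: "n \<bullet> z = cmod z / s" if "z \<in> pos_real_axis" for z
    using that cmod_pos_real_axis[OF that] by (simp add: n_def inner_complex_def pos_real_axis_def)
  have n_imag: "n \<bullet> z = cmod z / t" if "z \<in> pos_imag_axis" for z
    using that cmod_pos_imag_axis[OF that] by (simp add: n_def inner_complex_def pos_imag_axis_def)
  have "B \<subseteq> {z. n \<bullet> z \<le> 1}"
  proof
    fix z assume z: "z \<in> B"
    then consider "z \<in> pos_real_axis" | "z \<in> pos_imag_axis" using ax by blast
    then show "z \<in> {z. n \<bullet> z \<le> 1}"
      by cases (use z s t in \<open>simp_all add: n_real n_imag\<close>)
  qed
  then have "convex hull B \<subseteq> {z. n \<bullet> z \<le> 1}"
    by (rule hull_minimal) (rule convex_halfspace_le)
  moreover have "C \<subseteq> {z. n \<bullet> z > 1}"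
  proof
    fix z assume z: "z \<in> C"
    then consider "z \<in> pos_real_axis" | "z \<in> pos_imag_axis" using ax by blast
    then show "z \<in> {z. n \<bullet> z > 1}"
      by cases (use z s t in \<open>simp_all add: n_real n_imag\<close>)
  qed
  then have "convex hull C \<subseteq> {z. n \<bullet> z > 1}"
    by (rule hull_minimal) (rule convex_halfspace_gt)
  ultimately show ?thesis
    by fastforce
qed

text \<open>The two segments are the diagonals of the convex quadrilateral with vertices
  \<open>a\<close>, \<open>a'\<close>, \<open>b'\<close>, \<open>b\<close>.\<close>

lemma segments_cross:
  assumes "a \<in> pos_real_axis" "a' \<in> pos_real_axis" "b \<in> pos_imag_axis" "b' \<in> pos_imag_axis"
    and "cmod a < cmod a'" "cmod b < cmod b'"
  shows "closed_segment a b' \<inter> closed_segment a' b \<noteq> {}"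
proof -
  define s s' t t' where "s = Re a" and "s' = Re a'" and "t = Im b" and "t' = Im b'"
  have pos: "0 < s" "s < s'" "0 < t" "t < t'"
    using assms
    by (simp_all add: s_def s'_def t_def t'_def cmod_pos_real_axis cmod_pos_imag_axis)
       (simp_all add: pos_real_axis_def pos_imag_axis_def)
  have eqs: "a = Complex s 0" "a' = Complex s' 0" "b = Complex 0 t" "b' = Complex 0 t'"
    using assms
    by (simp_all add: s_def s'_def t_def t'_def pos_real_axis_def pos_imag_axis_def complex_eq_iff)
  define D where "D = s' * t' - s * t"
  have "s * t < s' * t'"
    using pos by (intro mult_strict_mono) auto
  then have D: "0 < D" by (simp add: D_def)
  txt \<open>The barycentric coordinates of the solution of
    \<open>X / s + Y / t' = 1\<close> and \<open>X / s' + Y / t = 1\<close>.\<close>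
  define k l where "k = t * (s' - s) / D" and "l = t' * (s' - s) / D"
  have "(1 - k) * s = (1 - l) * s'"
    using D unfolding k_def l_def by (simp add: field_simps) (simp add: D_def algebra_simps)
  moreover have "k * t' = l * t"
    by (simp add: k_def l_def)
  ultimately have "(1 - k) *\<^sub>R a + k *\<^sub>R b' = (1 - l) *\<^sub>R a' + l *\<^sub>R b"
    by (simp add: eqs complex_eq_iff)
  moreover have "0 \<le> k" "0 \<le> l"
    using pos D by (simp_all add: k_def l_def)
  moreover have "k \<le> 1"
  proof -
    have "D - t * (s' - s) = s' * (t' - t)"
      by (simp add: D_def algebra_simps)
    moreover have "0 \<le> s' * (t' - t)" using pos by simp
    ultimately show ?thesis using D by (simp add: k_def)
  qed
  moreover have "l \<le> 1"
  proof -
    have "D - t' * (s' - s) = s * (t' - t)"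
      by (simp add: D_def algebra_simps)
    moreover have "0 \<le> s * (t' - t)" using pos by simp
    ultimately show ?thesis using D by (simp add: l_def)
  qed
  ultimately have "(1 - k) *\<^sub>R a + k *\<^sub>R b' \<in> closed_segment a b'"
    "(1 - k) *\<^sub>R a + k *\<^sub>R b' \<in> closed_segment a' b"
    unfolding closed_segment_def by blast+
  then show ?thesis by blast
qed

lemma between_in_segment:
  assumes "coaxial a b" "coaxial b c" "cmod a < cmod b" "cmod b < cmod c"
  shows "b \<in> closed_segment a c"
proof -
  have "cmod a < cmod c" using assms by linarith
  define u where "u = (cmod b - cmod a) / (cmod c - cmod a)"
  have u: "0 \<le> u" "u \<le> 1"
    using assms by (simp_all add: u_def)
  have "u * (cmod c - cmod a) = cmod b - cmod a"
    using \<open>cmod a < cmod c\<close> by (simp add: u_def)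
  then have eq: "cmod b = (1 - u) * cmod a + u * cmod c"
    by (simp add: algebra_simps)
  consider "{a, b, c} \<subseteq> pos_real_axis" | "{a, b, c} \<subseteq> pos_imag_axis"
    using assms(1,2) by (auto simp: coaxial_def pos_real_axis_def pos_imag_axis_def)
  then have "b = (1 - u) *\<^sub>R a + u *\<^sub>R c"
  proof cases
    case 1
    then show ?thesis
      using eq by (simp add: cmod_pos_real_axis complex_eq_iff) (simp add: pos_real_axis_def)
  next
    case 2
    then show ?thesis
      using eq by (simp add: cmod_pos_imag_axis complex_eq_iff) (simp add: pos_imag_axis_def)
  qed
  then show ?thesis
    using u by (auto simp: closed_segment_def)
qed

text \<open>If both orders fail, some \<open>c\<close> lies inside \<open>b\<close> on one axis and
  some \<open>b'\<close> lies inside \<open>c'\<close> on an axis. On a common axis,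
  \<open>b\<close> or \<open>c'\<close> falls between two points of the other block; on different
  axes, a segment of \<open>B\<close> crosses one of \<open>C\<close>.\<close>

lemma hulls_disjoint_imp_below:
  assumes disj: "convex hull B \<inter> convex hull C = {}"
  shows "below B C \<or> below C B"
proof (rule ccontr)
  assume "\<not> ?thesis"
  then obtain b c b' c' where
    mem: "b \<in> B" "c \<in> C" "b' \<in> B" "c' \<in> C" and
    co: "coaxial b c" "coaxial b' c'" and le: "cmod c \<le> cmod b" "cmod b' \<le> cmod c'"
    unfolding below_def by (metis coaxial_sym not_less)
  have seg: "closed_segment x y \<inter> closed_segment z w = {}"
    if "x \<in> B" "y \<in> B" "z \<in> C" "w \<in> C" for x y z w
  proof -
    have "closed_segment x y \<subseteq> convex hull B" "closed_segment z w \<subseteq> convex hull C"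
      using that by (auto simp: segment_convex_hull intro!: hull_mono)
    then show ?thesis using disj by blast
  qed
  \<comment> \<open>Degenerate segments: a point common to both blocks would lie in both
    hulls.\<close>
  have ne: "x \<noteq> y" if "x \<in> B" "y \<in> C" for x y
    using seg[OF that(1) that(1) that(2) that(2)] by auto
  have lt: "cmod c < cmod b" "cmod b' < cmod c'"
    using le mem co ne coaxial_cmod_inj by (metis order_le_less)+
  show False
  proof (cases "coaxial b c'")
    case True
    then have "cmod b \<noteq> cmod c'"
      using coaxial_cmod_inj ne mem by blast
    then consider "cmod b < cmod c'" | "cmod c' < cmod b" by linarith
    then show False
    proof cases
      case 1
      then have "b \<in> closed_segment c c'"
        using between_in_segment True co lt coaxial_sym by blast
      then show False using seg[OF mem(1,1,2,4)] by auto
    next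
      case 2
      then have "c' \<in> closed_segment b' b"
        using between_in_segment True co lt coaxial_sym by blast
      then show False using seg[OF mem(3,1,4,4)] by auto
    qed
  next
    case False
    then consider "{b, c} \<subseteq> pos_real_axis" "{b', c'} \<subseteq> pos_imag_axis"
      | "{b, c} \<subseteq> pos_imag_axis" "{b', c'} \<subseteq> pos_real_axis"
      using co by (auto simp: coaxial_def)
    then show False
    proof cases
      case 1
      then show False
        using segments_cross[of c b b' c'] lt seg[OF mem(1,3,2,4)] by auto
    next
      case 2
      then show False
        using segments_cross[of b' c' c b] lt seg[OF mem(3,1,4,2)] by auto
    qed
  qed
qed

text \<open>From here on the geometry is replaced by the order relation \<open>below\<close> between
  blocks.\<close>

lemma mem_NC_iff:
  assumes "finite P" "P \<subseteq> axes"
  shows "\<pi> \<in> NC P \<longleftrightarrow>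
    partition_on P \<pi> \<and> (\<forall>B\<in>\<pi>. \<forall>C\<in>\<pi>. B \<noteq> C \<longrightarrow> below B C \<or> below C B)"
proof (cases "partition_on P \<pi>")
  case True
  have sub: "B \<subseteq> P" if "B \<in> \<pi>" for B
    using True that by (auto simp: partition_on_def)
  have "convex hull B \<inter> convex hull C = {} \<longleftrightarrow> below B C \<or> below C B"
    if "B \<in> \<pi>" "C \<in> \<pi>" for B C
  proof -
    have "finite B" "finite C" "B \<subseteq> axes" "C \<subseteq> axes"
      using sub[OF that(1)] sub[OF that(2)] assms by (auto intro: finite_subset)
    then show ?thesis
      using below_imp_hulls_disjoint[of B C] below_imp_hulls_disjoint[of C B]
        hulls_disjoint_imp_below[of B C] by auto
  qed
  then show ?thesis
    using True by (auto simp: NC_def disjoint_family_on_def)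
qed (simp add: NC_def)

lemma NC_D:
  assumes "finite P" "P \<subseteq> axes" "\<pi> \<in> NC P"
  shows "partition_on P \<pi>"
    and "\<And>B C. B \<in> \<pi> \<Longrightarrow> C \<in> \<pi> \<Longrightarrow> B \<noteq> C \<Longrightarrow> below B C \<or> below C B"
  using assms by (auto simp: mem_NC_iff)

lemma finite_NC:
  assumes "finite P" shows "finite (NC P)"
proof (rule finite_subset)
  show "NC P \<subseteq> Pow (Pow P)"
    by (auto simp: NC_def partition_on_def)
qed (use assms in simp)

section \<open>Removing the outermost point of an axis\<close>

definition outermost :: "complex set \<Rightarrow> complex \<Rightarrow> bool" where
  "outermost P p \<longleftrightarrow> p \<in> P \<and> (\<forall>x\<in>P. coaxial x p \<longrightarrow> x \<noteq> p \<longrightarrow> cmod x < cmod p)"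

text \<open>Any other point of the axis may share the block. For an outermost \<open>p\<close> in a
  noncrossing partition, the predecessor of \<open>p\<close> then belongs to the block too, as the
  proof of \<open>card_NC_joined\<close> shows.\<close>

definition joined :: "complex \<Rightarrow> complex set set \<Rightarrow> bool" where
  "joined p \<pi> \<longleftrightarrow> (\<exists>B\<in>\<pi>. p \<in> B \<and> (\<exists>x\<in>B. x \<noteq> p \<and> coaxial x p))"

definition adjoin :: "complex \<Rightarrow> complex \<Rightarrow> complex set set \<Rightarrow> complex set set" where
  "adjoin p p' \<rho> = (\<lambda>B. if p' \<in> B then insert p B else B) ` \<rho>"

lemma outermost_subset: "outermost P p \<Longrightarrow> Q \<subseteq> P \<Longrightarrow> p \<in> Q \<Longrightarrow> outermost Q p"
  by (auto simp: outermost_def)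

lemma obtain_outermost:
  assumes "finite P" "x \<in> P" "x \<in> axes"
  obtains p where "outermost P p" "coaxial p x"
proof -
  let ?S = "{z \<in> P. coaxial z x}"
  have S: "finite (cmod ` ?S)" "cmod ` ?S \<noteq> {}"
    using assms coaxial_refl by auto
  then obtain p where p: "p \<in> ?S" "cmod p = Max (cmod ` ?S)"
    using Max_in[OF S] by force
  have "cmod z < cmod p" if "z \<in> P" "coaxial z p" "z \<noteq> p" for z
  proof -
    have "coaxial z x" using that p coaxial_trans by blast
    then have "cmod z \<le> cmod p" using that p S by simp
    then show ?thesis using that coaxial_cmod_inj by (metis order_le_less)
  qed
  then have "outermost P p" using p by (simp add: outermost_def)
  then show ?thesis using that p by blast
qed

lemma below_outermost:
  assumes "\<And>t. t \<in> T \<Longrightarrow> outermost P t" "B \<subseteq> P - T"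
  shows "below B T"
  unfolding below_def
proof (intro ballI impI)
  fix b t assume "b \<in> B" "t \<in> T" "coaxial b t"
  then show "cmod b < cmod t"
    using assms(1)[of t] assms(2) by (auto simp: outermost_def)
qed

text \<open>Every block of the remaining points is below \<open>T\<close>, so adding or deleting
  \<open>T\<close> keeps a partition noncrossing. It is applied to \<open>{p}\<close> and to
  \<open>{p, q}\<close>; the condition \<open>\<Phi>\<close> lets counts for two points be
  combined.\<close>

lemma card_NC_block:
  assumes P: "finite P" "P \<subseteq> axes" and T: "T \<noteq> {}" "\<And>t. t \<in> T \<Longrightarrow> outermost P t"
    and \<Phi>: "\<And>\<rho>. \<rho> \<in> NC (P - T) \<Longrightarrow> \<Phi> (insert T \<rho>) \<longleftrightarrow> \<Phi> \<rho>"
  shows "card {\<pi> \<in> NC P. T \<in> \<pi> \<and> \<Phi> \<pi>} = card {\<rho> \<in> NC (P - T). \<Phi> \<rho>}"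
proof -
  have TP: "T \<subseteq> P" using T(2) by (auto simp: outermost_def)
  have P': "finite (P - T)" "P - T \<subseteq> axes" using P by auto
  have part: "partition_on (P - T) \<rho>" if "\<rho> \<in> NC (P - T)" for \<rho>
    using NC_D[OF P' that] by blast
  have notin: "T \<notin> \<rho>" if "\<rho> \<in> NC (P - T)" for \<rho>
    using part[OF that] T(1) by (auto simp: partition_on_def)
  have ins: "insert T \<rho> \<in> NC P" if \<rho>: "\<rho> \<in> NC (P - T)" for \<rho>
  proof -
    have "below B T" if "B \<in> \<rho>" for B
      by (rule below_outermost[OF T(2)]) (use part[OF \<rho>] that in \<open>auto simp: partition_on_def\<close>)
    moreover have "partition_on P (insert T \<rho>)"
      using part[OF \<rho>] T(1) TP unfolding partition_on_def disjoint_def by auto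
    ultimately show ?thesis
      using NC_D(2)[OF P' \<rho>] by (auto simp: mem_NC_iff[OF P])
  qed
  have del: "\<pi> - {T} \<in> NC (P - T)" if "\<pi> \<in> NC P" "T \<in> \<pi>" for \<pi>
  proof -
    have "partition_on P \<pi>" using NC_D[OF P that(1)] by blast
    then have "partition_on (P - T) (\<pi> - {T})"
      using that(2) by (auto simp: partition_on_def disjoint_def)
    then show ?thesis
      using NC_D(2)[OF P that(1)] by (auto simp: mem_NC_iff[OF P'])
  qed
  have "bij_betw (insert T) {\<rho> \<in> NC (P - T). \<Phi> \<rho>} {\<pi> \<in> NC P. T \<in> \<pi> \<and> \<Phi> \<pi>}"
  proof (rule bij_betw_byWitness[where f' = "\<lambda>\<pi>. \<pi> - {T}"])
    show "(\<lambda>\<pi>. \<pi> - {T}) ` {\<pi> \<in> NC P. T \<in> \<pi> \<and> \<Phi> \<pi>} \<subseteq> {\<rho> \<in> NC (P - T). \<Phi> \<rho>}"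
      using del \<Phi> by (auto simp: insert_absorb) (metis insert_Diff)
  qed (use notin ins \<Phi> in auto)
  then show ?thesis
    by (rule bij_betw_same_card[symmetric])
qed

text \<open>Since \<open>p'\<close> immediately precedes \<open>p\<close> on its axis, no other
  block can tell whether \<open>p\<close> is present in the block of \<open>p'\<close>. Hence
  \<open>adjoin p p'\<close> and deletion of \<open>p\<close> are mutually inverse.\<close>

lemma card_NC_joined:
  assumes P: "finite P" "P \<subseteq> axes" and p: "outermost P p"
    and p': "outermost (P - {p}) p'" "coaxial p' p"
    and \<Phi>: "\<And>\<rho>. \<rho> \<in> NC (P - {p}) \<Longrightarrow> \<Phi> (adjoin p p' \<rho>) \<longleftrightarrow> \<Phi> \<rho>"
  shows "card {\<pi> \<in> NC P. joined p \<pi> \<and> \<Phi> \<pi>} = card {\<rho> \<in> NC (P - {p}). \<Phi> \<rho>}"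
proof -
  have P': "finite (P - {p})" "P - {p} \<subseteq> axes" using P by auto
  have pP: "p \<in> P" "p' \<in> P" "p \<noteq> p'" using p p' by (auto simp: outermost_def)
  have lt: "cmod p' < cmod p" using p p' by (auto simp: outermost_def)
  define del where "del = (\<lambda>\<pi>. (\<lambda>B. B - {p}) ` \<pi>)"
  have part: "partition_on (P - {p}) \<rho>" if "\<rho> \<in> NC (P - {p})" for \<rho>
    using NC_D[OF P' that] by blast
  have del_adjoin: "del (adjoin p p' \<rho>) = \<rho>" if "\<rho> \<in> NC (P - {p})" for \<rho>
  proof -
    have "(if p' \<in> B then insert p B else B) - {p} = B" if "B \<in> \<rho>" for B
      using part[OF \<open>\<rho> \<in> _\<close>] that by (auto simp: partition_on_def)
    then have "del (adjoin p p' \<rho>) = (\<lambda>B. B) ` \<rho>"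
      unfolding del_def adjoin_def image_image by (rule image_cong[OF refl])
    then show ?thesis by simp
  qed
  have adjoin_in: "adjoin p p' \<rho> \<in> NC P" "joined p (adjoin p p' \<rho>)"
    if \<rho>: "\<rho> \<in> NC (P - {p})" for \<rho>
  proof -
    note part = part[OF \<rho>]
    obtain B0 where B0: "B0 \<in> \<rho>" "p' \<in> B0"
      using part pP by (auto simp: partition_on_def)
    have uniq: "B = B0" if "B \<in> \<rho>" "p' \<in> B" for B
      using part that B0 by (auto simp: partition_on_def disjoint_def)
    have eq: "adjoin p p' \<rho> = insert (insert p B0) (\<rho> - {B0})"
    proof -
      have "adjoin p p' \<rho> = (\<lambda>B. if B = B0 then insert p B else B) ` \<rho>"
        unfolding adjoin_def by (rule image_cong[OF refl]) (use B0 uniq in metis)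
      also have "\<dots> = insert (insert p B0) (\<rho> - {B0})"
        using B0(1) by (auto simp: image_iff)
      finally show ?thesis .
    qed
    show "joined p (adjoin p p' \<rho>)"
      using B0 pP p'(2) by (auto simp: eq joined_def)
    have "partition_on P (adjoin p p' \<rho>)"
      using part B0 pP unfolding eq partition_on_def disjoint_def by auto
    moreover have "below (insert p B0) C \<or> below C (insert p B0)" if C: "C \<in> \<rho>" "C \<noteq> B0" for C
    proof -
      have CP: "C \<subseteq> P - {p}" using part C by (auto simp: partition_on_def)
      have Cp: "below C {p}"
        by (rule below_outermost[of _ P]) (use p CP in auto)
      consider "below B0 C" | "below C B0" using NC_D(2)[OF P' \<rho>] C B0 by blast
      then show ?thesis
      proof cases
        case 1
        \<comment> \<open>As \<open>p'\<close> is the last remaining point of its axis, a block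
          above \<open>B0\<close> has no point there, so inserting \<open>p\<close> creates no new
          comparison with it.\<close>
        have "\<not> coaxial p c" if "c \<in> C" for c
        proof
          assume "coaxial p c"
          then have co: "coaxial p' c" using p' coaxial_trans by blast
          then have "cmod p' < cmod c" using 1 B0 that by (auto simp: below_def)
          moreover have "cmod c \<le> cmod p'"
            using p'(1) co CP that unfolding outermost_def
            by (metis coaxial_sym less_le_not_le order_refl subsetD)
          ultimately show False by simp
        qed
        then show ?thesis using 1 by (auto simp: below_def)
      next
        case 2
        then show ?thesis using Cp by (auto simp: below_def)
      qed
    qed
    ultimately show "adjoin p p' \<rho> \<in> NC P"
      using NC_D(2)[OF P' \<rho>] unfolding mem_NC_iff[OF P] eq by blast
  qed
  have del_in: "del \<pi> \<in> NC (P - {p}) \<and> adjoin p p' (del \<pi>) = \<pi>"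
    if \<pi>: "\<pi> \<in> NC P" "joined p \<pi>" for \<pi>
  proof -
    have part: "partition_on P \<pi>" using NC_D[OF P \<pi>(1)] by blast
    obtain B0 x where B0: "B0 \<in> \<pi>" "p \<in> B0" "x \<in> B0" "x \<noteq> p" "coaxial x p"
      using \<pi>(2) by (auto simp: joined_def)
    have uniq: "B = C" if "B \<in> \<pi>" "C \<in> \<pi>" "z \<in> B" "z \<in> C" for B C z
      using part that by (auto simp: partition_on_def disjoint_def)
    \<comment> \<open>Otherwise \<open>x\<close>, \<open>p'\<close>, \<open>p\<close> follow each
      other on one axis with \<open>x\<close> and \<open>p\<close> in \<open>B0\<close> and
      \<open>p'\<close> in another block \<open>D\<close>, which rules out both orders of
      \<open>B0\<close> and \<open>D\<close>.\<close>
    have p'B0: "p' \<in> B0"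
    proof (rule ccontr)
      assume n: "p' \<notin> B0"
      obtain D where D: "D \<in> \<pi>" "p' \<in> D" using part pP by (auto simp: partition_on_def)
      have co: "coaxial x p'" using B0 p' coaxial_sym coaxial_trans by blast
      have "x \<in> P" using part B0 by (auto simp: partition_on_def)
      then have "cmod x < cmod p'"
        using p'(1) co n B0 by (auto simp: outermost_def)
      moreover have "below B0 D \<or> below D B0" using NC_D(2)[OF P \<pi>(1) B0(1) D(1)] n D by blast
      ultimately show False
        using B0 D lt co p'(2) coaxial_sym unfolding below_def by (meson order_less_asym)
    qed
    have eq: "del \<pi> = insert (B0 - {p}) (\<pi> - {B0})"
    proof -
      have "B - {p} = (if B = B0 then B0 - {p} else B)" if "B \<in> \<pi>" for B
        using uniq[OF that B0(1) _ B0(2)] by auto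
      then have "del \<pi> = (\<lambda>B. if B = B0 then B0 - {p} else B) ` \<pi>"
        unfolding del_def by (rule image_cong[OF refl])
      then show ?thesis using B0(1) by (auto simp: image_iff)
    qed
    have "partition_on (P - {p}) (del \<pi>)"
    proof (rule partition_onI)
      show "\<Union> (del \<pi>) = P - {p}"
        using part by (auto simp: del_def partition_on_def)
      show "disjnt B C" if "B \<in> del \<pi>" "C \<in> del \<pi>" "B \<noteq> C" for B C
        using that uniq by (auto simp: del_def disjnt_def)
      \<comment> \<open>The only block that shrinks is \<open>B0\<close>, and it keeps
        \<open>p'\<close>.\<close>
      show "{} \<notin> del \<pi>"
        using part p'B0 pP by (auto simp: eq partition_on_def)
    qed
    moreover have "below B C \<or> below C B" if BC: "B \<in> del \<pi>" "C \<in> del \<pi>" "B \<noteq> C" for B C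
    proof -
      obtain B' C' where *: "B' \<in> \<pi>" "C' \<in> \<pi>" "B = B' - {p}" "C = C' - {p}"
        using BC(1,2) unfolding del_def by blast
      moreover from this have "B' \<noteq> C'" using BC(3) by blast
      ultimately have "below B' C' \<or> below C' B'" using NC_D(2)[OF P \<pi>(1)] by blast
      then show ?thesis using * by (auto simp: below_def)
    qed
    moreover have "adjoin p p' (del \<pi>) = \<pi>"
    proof -
      have "(if p' \<in> B - {p} then insert p (B - {p}) else B - {p}) = B" if "B \<in> \<pi>" for B
        using uniq[OF that B0(1)] p'B0 pP B0(2) by (cases "B = B0") auto
      then have "adjoin p p' (del \<pi>) = (\<lambda>B. B) ` \<pi>"
        unfolding del_def adjoin_def image_image by (rule image_cong[OF refl])
      then show ?thesis by simp
    qed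
    ultimately show ?thesis by (auto simp: mem_NC_iff[OF P'])
  qed
  have "bij_betw (adjoin p p') {\<rho> \<in> NC (P - {p}). \<Phi> \<rho>} {\<pi> \<in> NC P. joined p \<pi> \<and> \<Phi> \<pi>}"
  proof (rule bij_betw_byWitness[where f' = del])
    show "del ` {\<pi> \<in> NC P. joined p \<pi> \<and> \<Phi> \<pi>} \<subseteq> {\<rho> \<in> NC (P - {p}). \<Phi> \<rho>}"
      using del_in \<Phi> by fastforce
  qed (use del_adjoin adjoin_in del_in \<Phi> in auto)
  then show ?thesis
    by (rule bij_betw_same_card[symmetric])
qed

section \<open>Inclusion-exclusion over the two outermost points\<close>

definition detachable :: "complex \<Rightarrow> complex set set \<Rightarrow> bool" where
  "detachable p \<pi> \<longleftrightarrow> {p} \<in> \<pi> \<or> joined p \<pi>"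

text \<open>The number of ways to put back an outermost point that has \<open>m\<close> other points on its axis, as a
  singleton or next to its predecessor.\<close>

definition weight :: "nat \<Rightarrow> nat" where
  "weight m = (if m = 0 then 1 else 2)"

definition axis_rest :: "complex set \<Rightarrow> complex \<Rightarrow> complex set" where
  "axis_rest P p = {x \<in> P. x \<noteq> p \<and> coaxial x p}"

text \<open>The singleton and the joined case exclude each other, and each is counted by the
  partitions of the remaining points. The joined case disappears if \<open>p\<close> is alone on its
  axis, whence \<open>weight\<close>.\<close>

lemma card_NC_detachable:
  assumes P: "finite P" "P \<subseteq> axes" and p: "outermost P p"
    and \<Phi>1: "\<And>\<rho>. \<rho> \<in> NC (P - {p}) \<Longrightarrow> \<Phi> (insert {p} \<rho>) \<longleftrightarrow> \<Phi> \<rho>"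
    and \<Phi>2: "\<And>\<rho> p'. \<rho> \<in> NC (P - {p}) \<Longrightarrow> coaxial p' p \<Longrightarrow> \<Phi> (adjoin p p' \<rho>) \<longleftrightarrow> \<Phi> \<rho>"
  shows "card {\<pi> \<in> NC P. detachable p \<pi> \<and> \<Phi> \<pi>} =
    weight (card (axis_rest P p)) * card {\<rho> \<in> NC (P - {p}). \<Phi> \<rho>}"
proof -
  have part: "partition_on P \<pi>" if "\<pi> \<in> NC P" for \<pi>
    using NC_D[OF P that] by blast
  have fin: "finite (axis_rest P p)" using P by (simp add: axis_rest_def)
  have isolated: "card {\<pi> \<in> NC P. {p} \<in> \<pi> \<and> \<Phi> \<pi>} = card {\<rho> \<in> NC (P - {p}). \<Phi> \<rho>}"
    by (rule card_NC_block) (use P p \<Phi>1 in auto)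
  have joined: "card {\<pi> \<in> NC P. joined p \<pi> \<and> \<Phi> \<pi>} =
    (if axis_rest P p = {} then 0 else card {\<rho> \<in> NC (P - {p}). \<Phi> \<rho>})"
  proof (cases "axis_rest P p = {}")
    case True
    have "\<not> joined p \<pi>" if "\<pi> \<in> NC P" for \<pi>
      using True part[OF that] by (auto simp: axis_rest_def joined_def partition_on_def)
    then have "{\<pi> \<in> NC P. joined p \<pi> \<and> \<Phi> \<pi>} = {}" by blast
    then show ?thesis by (simp only: True card.empty if_True simp_thms)
  next
    case False
    then obtain x where x: "x \<in> P - {p}" "coaxial x p" by (auto simp: axis_rest_def)
    then obtain p' where p': "outermost (P - {p}) p'" "coaxial p' x"
      using obtain_outermost[of "P - {p}" x] P by auto
    have "coaxial p' p" using p' x coaxial_trans by blast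
    then show ?thesis
      using False card_NC_joined[OF P p p'(1)] \<Phi>2 by simp
  qed
  have "{\<pi> \<in> NC P. detachable p \<pi> \<and> \<Phi> \<pi>} =
      {\<pi> \<in> NC P. {p} \<in> \<pi> \<and> \<Phi> \<pi>} \<union> {\<pi> \<in> NC P. joined p \<pi> \<and> \<Phi> \<pi>}"
    by (auto simp: detachable_def)
  moreover have "\<not> joined p \<pi>" if "\<pi> \<in> NC P" "{p} \<in> \<pi>" for \<pi>
    using part[OF that(1)] that(2) by (fastforce simp: joined_def partition_on_def disjoint_def)
  then have "{\<pi> \<in> NC P. {p} \<in> \<pi> \<and> \<Phi> \<pi>} \<inter> {\<pi> \<in> NC P. joined p \<pi> \<and> \<Phi> \<pi>} = {}"
    by blast
  ultimately have "card {\<pi> \<in> NC P. detachable p \<pi> \<and> \<Phi> \<pi>} =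
      card {\<pi> \<in> NC P. {p} \<in> \<pi> \<and> \<Phi> \<pi>} + card {\<pi> \<in> NC P. joined p \<pi> \<and> \<Phi> \<pi>}"
    using finite_NC[OF P(1)] by (simp add: card_Un_disjoint)
  then show ?thesis
    using isolated joined fin by (simp add: weight_def)
qed

text \<open>Any companion of \<open>p\<close> in its block is coaxial with \<open>p\<close>, so
  \<open>p\<close> is always detachable.\<close>

lemma card_NC_single_axis:
  assumes P: "finite P" "P \<subseteq> axes" and p: "outermost P p" and all: "\<And>x. x \<in> P \<Longrightarrow> coaxial x p"
  shows "card (NC P) = weight (card (axis_rest P p)) * card (NC (P - {p}))"
proof -
  have "detachable p \<pi>" if "\<pi> \<in> NC P" for \<pi>
  proof -
    have part: "partition_on P \<pi>" using NC_D[OF P that] by blast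
    then obtain B where B: "B \<in> \<pi>" "p \<in> B"
      using p by (auto simp: outermost_def partition_on_def)
    then have "B \<subseteq> P" using part by (auto simp: partition_on_def)
    show ?thesis
    proof (cases "B = {p}")
      case False
      then obtain x where "x \<in> B" "x \<noteq> p" using B by blast
      then show ?thesis
        using B all \<open>B \<subseteq> P\<close> by (auto simp: detachable_def joined_def)
    qed (use B in \<open>simp add: detachable_def\<close>)
  qed
  then have "NC P = {\<pi> \<in> NC P. detachable p \<pi>}" by blast
  then show ?thesis
    using card_NC_detachable[OF P p, of "\<lambda>_. True"] by simp
qed

text \<open>If the block of \<open>p\<close> meets the axis of \<open>p\<close> only in \<open>p\<close> and contains a point of the other
  axis, and likewise for \<open>q\<close>, then these two blocks cross unless they coincide.\<close>

lemma not_detachable_iff: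
  assumes P: "finite P" "P \<subseteq> axes" and p: "outermost P p" and q: "outermost P q"
    and pq: "\<not> coaxial p q" and \<pi>: "\<pi> \<in> NC P"
  shows "\<not> detachable p \<pi> \<and> \<not> detachable q \<pi> \<longleftrightarrow> {p, q} \<in> \<pi>"
proof -
  have part: "partition_on P \<pi>" using NC_D[OF P \<pi>] by blast
  have mem: "p \<in> P" "q \<in> P" using p q by (auto simp: outermost_def)
  have ne: "p \<noteq> q" using pq mem P coaxial_refl by blast
  have uniq: "B = C" if "B \<in> \<pi>" "C \<in> \<pi>" "z \<in> B" "z \<in> C" for B C z
    using part that by (auto simp: partition_on_def disjoint_def)
  have axis: "coaxial x p \<or> coaxial x q" if "x \<in> P" for x
    using that mem pq P(2) by (auto simp: coaxial_def)
  show ?thesis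
  proof
    assume nd: "\<not> detachable p \<pi> \<and> \<not> detachable q \<pi>"
    obtain B where B: "B \<in> \<pi>" "p \<in> B" using part mem by (auto simp: partition_on_def)
    obtain C where C: "C \<in> \<pi>" "q \<in> C" using part mem by (auto simp: partition_on_def)
    have sub: "B \<subseteq> P" "C \<subseteq> P" using part B C by (auto simp: partition_on_def)
    have Bq: "coaxial y q" if "y \<in> B" "y \<noteq> p" for y
    proof -
      have "\<not> coaxial y p"
        using nd B that unfolding detachable_def joined_def by blast
      then show ?thesis using axis sub that by blast
    qed
    have Cp: "coaxial x p" if "x \<in> C" "x \<noteq> q" for x
    proof -
      have "\<not> coaxial x q"
        using nd C that unfolding detachable_def joined_def by blast
      then show ?thesis using axis sub that by blast
    qed
    have "B \<noteq> {p}" "C \<noteq> {q}" using nd B C by (auto simp: detachable_def)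
    then obtain x y where y: "y \<in> B" "y \<noteq> p" and x: "x \<in> C" "x \<noteq> q" using B C by blast
    have "B = C"
    proof (rule ccontr)
      assume "B \<noteq> C"
      then have "x \<noteq> p" "y \<noteq> q" using uniq B C x y by blast+
      then have lt: "cmod x < cmod p" "cmod y < cmod q"
        using p q x y Bq Cp sub by (auto simp: outermost_def)
      \<comment> \<open>The first order would put \<open>p\<close> inside \<open>x\<close>, the
        second \<open>q\<close> inside \<open>y\<close>, although \<open>p\<close> and
        \<open>q\<close> are outermost.\<close>
      have "below B C \<or> below C B" using NC_D(2)[OF P \<pi>] B C \<open>B \<noteq> C\<close> by blast
      then show False
        using lt Bq[OF y] Cp[OF x] B C x y coaxial_sym unfolding below_def
        by (meson order_less_asym)
    qed
    \<comment> \<open>A third point of the common block would be coaxial with both \<open>p\<close>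
      and \<open>q\<close>.\<close>
    moreover have "B \<subseteq> {p, q}"
      using Bq Cp \<open>B = C\<close> pq coaxial_sym coaxial_trans by blast
    ultimately show "{p, q} \<in> \<pi>"
      using B C by (metis insert_subset empty_subsetI subset_antisym)
  next
    assume pair: "{p, q} \<in> \<pi>"
    have block: "B = {p, q}" if "B \<in> \<pi>" "p \<in> B \<or> q \<in> B" for B
      using uniq[OF that(1) pair] that(2) by blast
    then show "\<not> detachable p \<pi> \<and> \<not> detachable q \<pi>"
      using ne pq coaxial_sym unfolding detachable_def joined_def by blast
  qed
qed

text \<open>This and the next lemma show that restoring \<open>p\<close> does not affect whether
  \<open>q\<close> is detachable, so \<open>card_NC_detachable\<close> applies with this condition
  as \<open>\<Phi>\<close>.\<close>

lemma detachable_insert: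
  assumes "p \<noteq> q"
  shows "detachable q (insert {p} \<rho>) \<longleftrightarrow> detachable q \<rho>"
  using assms by (auto simp: detachable_def joined_def)

text \<open>The altered block contains \<open>p'\<close>, which differs from \<open>q\<close>, so it
  is never \<open>{q}\<close>; and \<open>p\<close> lies on the wrong axis to be a companion of
  \<open>q\<close>.\<close>

lemma detachable_adjoin:
  assumes "p \<noteq> q" "\<not> coaxial p q" "coaxial p' p"
  shows "detachable q (adjoin p p' \<rho>) \<longleftrightarrow> detachable q \<rho>"
proof -
  have "p' \<noteq> q" using assms coaxial_sym by blast
  then have "{q} \<in> adjoin p p' \<rho> \<longleftrightarrow> {q} \<in> \<rho>"
    using assms(1) by (auto simp: adjoin_def image_iff)
  moreover have "joined q (adjoin p p' \<rho>) \<longleftrightarrow> joined q \<rho>"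
  proof -
    have "(q \<in> (if p' \<in> B then insert p B else B) \<and>
        (\<exists>x\<in>if p' \<in> B then insert p B else B. x \<noteq> q \<and> coaxial x q)) \<longleftrightarrow>
      q \<in> B \<and> (\<exists>x\<in>B. x \<noteq> q \<and> coaxial x q)" for B
      using assms by auto
    then show ?thesis
      unfolding joined_def adjoin_def bex_simps by simp
  qed
  ultimately show ?thesis by (simp add: detachable_def)
qed

text \<open>The sets \<open>A\<close> and \<open>B\<close> of partitions with \<open>p\<close> or
  \<open>q\<close> detachable overlap, and by \<open>not_detachable_iff\<close> the complement of
  their union is \<open>C\<close>. The overlap term stands on the left to avoid subtraction of
  natural numbers.\<close>

lemma card_NC_two_axes:
  assumes P: "finite P" "P \<subseteq> axes" and p: "outermost P p" and q: "outermost P q"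
    and pq: "\<not> coaxial p q"
  defines "a \<equiv> weight (card (axis_rest P p))" and "b \<equiv> weight (card (axis_rest P q))"
  shows "card (NC P) + a * b * card (NC (P - {p} - {q})) =
    a * card (NC (P - {p})) + b * card (NC (P - {q})) + card (NC (P - {p} - {q}))"
proof -
  have mem: "p \<in> P" "q \<in> P" using p q by (auto simp: outermost_def)
  have ne: "p \<noteq> q" using pq mem P coaxial_refl by blast
  have P': "finite (P - {p})" "P - {p} \<subseteq> axes" using P by auto
  define A where "A = {\<pi> \<in> NC P. detachable p \<pi>}"
  define B where "B = {\<pi> \<in> NC P. detachable q \<pi>}"
  define C where "C = {\<pi> \<in> NC P. {p, q} \<in> \<pi>}"
  have fin: "finite A" "finite B" "finite C"
    using finite_NC[OF P(1)] by (simp_all add: A_def B_def C_def)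
  have A: "card A = a * card (NC (P - {p}))"
    using card_NC_detachable[OF P p, of "\<lambda>_. True"] by (simp add: A_def a_def)
  have B: "card B = b * card (NC (P - {q}))"
    using card_NC_detachable[OF P q, of "\<lambda>_. True"] by (simp add: B_def b_def)
  have q': "outermost (P - {p}) q"
    by (rule outermost_subset[OF q]) (use ne mem in auto)
  \<comment> \<open>Removing \<open>p\<close> does not touch the axis of \<open>q\<close>, so
    \<open>q\<close> keeps its weight \<open>b\<close>.\<close>
  have rest: "axis_rest (P - {p}) q = axis_rest P q"
    using pq by (auto simp: axis_rest_def)
  \<comment> \<open>The overlap is counted in two rounds: first \<open>p\<close> is removed while
    \<open>q\<close> stays detachable, then \<open>q\<close> is removed from
    \<open>P - {p}\<close>.\<close>
  have "A \<inter> B = {\<pi> \<in> NC P. detachable p \<pi> \<and> detachable q \<pi>}"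
    by (auto simp: A_def B_def)
  also have "card \<dots> = a * card {\<rho> \<in> NC (P - {p}). detachable q \<rho>}"
    unfolding a_def using ne pq detachable_insert detachable_adjoin
    by (intro card_NC_detachable[OF P p]) blast+
  also have "card {\<rho> \<in> NC (P - {p}). detachable q \<rho>} = b * card (NC (P - {p} - {q}))"
    using card_NC_detachable[OF P' q', of "\<lambda>_. True"] by (simp add: b_def rest)
  finally have AB: "card (A \<inter> B) = a * b * card (NC (P - {p} - {q}))" by simp
  have C: "card C = card (NC (P - {p} - {q}))"
  proof -
    have "card {\<pi> \<in> NC P. {p, q} \<in> \<pi> \<and> True} = card {\<rho> \<in> NC (P - {p, q}). True}"
      by (rule card_NC_block) (use P p q in auto)
    moreover have "P - {p, q} = P - {p} - {q}" by blast
    ultimately show ?thesis by (simp add: C_def)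
  qed
  have "NC P = (A \<union> B) \<union> C" "(A \<union> B) \<inter> C = {}"
    using not_detachable_iff[OF P p q pq] by (auto simp: A_def B_def C_def)
  then have "card (NC P) = card (A \<union> B) + card C"
    using fin by (metis card_Un_disjoint finite_UnI)
  moreover have "card A + card B = card (A \<union> B) + card (A \<inter> B)"
    by (rule card_Un_Int) (use fin in auto)
  ultimately show ?thesis using A B AB C by simp
qed

section \<open>The generating function\<close>

text \<open>Unlike in \<open>nc_count\<close>, the empty configuration counts \<open>1\<close>, as the recurrence requires.\<close>

fun nc_number :: "nat \<Rightarrow> nat \<Rightarrow> int" where
  "nc_number 0 0 = 1"
| "nc_number (Suc m) 0 = weight m * nc_number m 0"
| "nc_number 0 (Suc n) = weight n * nc_number 0 n"
| "nc_number (Suc m) (Suc n) = weight m * nc_number m (Suc n) + weight n * nc_number (Suc m) n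
     - weight m * weight n * nc_number m n + nc_number m n"

lemma axes_disjoint: "z \<in> pos_real_axis \<Longrightarrow> z \<notin> pos_imag_axis"
  by (simp add: pos_real_axis_def pos_imag_axis_def)

text \<open>The argument of \<open>weight\<close> is the number \<open>m\<close> of points left on
  the axis, not the original \<open>Suc m\<close>.\<close>

lemma remove_outermost_real:
  assumes "axis_configuration (Suc m) n P"
  obtains p where "p \<in> pos_real_axis" "outermost P p" "card (axis_rest P p) = m"
    "axis_configuration m n (P - {p})"
proof -
  have P: "finite P" "P \<subseteq> axes" "card (P \<inter> pos_real_axis) = Suc m" "card (P \<inter> pos_imag_axis) = n"
    using assms by (auto simp: axis_configuration_def)
  then have "P \<inter> pos_real_axis \<noteq> {}" by auto
  then obtain x where x: "x \<in> P" "x \<in> pos_real_axis" by blast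
  then obtain p where p: "outermost P p" "coaxial p x" using obtain_outermost P by blast
  have pr: "p \<in> pos_real_axis" using p x axes_disjoint by (auto simp: coaxial_def)
  have "axis_rest P p = P \<inter> pos_real_axis - {p}" "(P - {p}) \<inter> pos_real_axis = P \<inter> pos_real_axis - {p}"
    "(P - {p}) \<inter> pos_imag_axis = P \<inter> pos_imag_axis"
    using pr axes_disjoint by (auto simp: axis_rest_def coaxial_def)
  moreover have "card (P \<inter> pos_real_axis - {p}) = m"
    using P pr p by (simp add: outermost_def)
  ultimately show ?thesis
    using that[OF pr p(1)] P by (auto simp: axis_configuration_def)
qed

lemma remove_outermost_imag:
  assumes "axis_configuration m (Suc n) P"
  obtains p where "p \<in> pos_imag_axis" "outermost P p" "card (axis_rest P p) = n"
    "axis_configuration m n (P - {p})"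
proof -
  have P: "finite P" "P \<subseteq> axes" "card (P \<inter> pos_real_axis) = m" "card (P \<inter> pos_imag_axis) = Suc n"
    using assms by (auto simp: axis_configuration_def)
  then have "P \<inter> pos_imag_axis \<noteq> {}" by auto
  then obtain x where x: "x \<in> P" "x \<in> pos_imag_axis" by blast
  then obtain p where p: "outermost P p" "coaxial p x" using obtain_outermost P by blast
  have pr: "p \<in> pos_imag_axis" using p x axes_disjoint by (auto simp: coaxial_def)
  have "axis_rest P p = P \<inter> pos_imag_axis - {p}" "(P - {p}) \<inter> pos_imag_axis = P \<inter> pos_imag_axis - {p}"
    "(P - {p}) \<inter> pos_real_axis = P \<inter> pos_real_axis"
    using pr axes_disjoint by (auto simp: axis_rest_def coaxial_def)
  moreover have "card (P \<inter> pos_imag_axis - {p}) = n"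
    using P pr p by (simp add: outermost_def)
  ultimately show ?thesis
    using that[OF pr p(1)] P by (auto simp: axis_configuration_def)
qed

text \<open>The induction ranges over all configurations \<open>P\<close> of the given size, since
  removing outermost points need not lead to members of a prescribed family.\<close>

lemma card_NC_eq_nc_number: "axis_configuration m n P \<Longrightarrow> int (card (NC P)) = nc_number m n"
proof (induction m n arbitrary: P rule: nc_number.induct)
  case 1
  then have "P = {}" by (fastforce simp: axis_configuration_def)
  moreover have "NC {} = {{}}"
    by (auto simp: NC_def partition_on_empty disjoint_family_on_def)
  ultimately show ?case by simp
next
  case (2 m)
  obtain p where p: "p \<in> pos_real_axis" "outermost P p" "card (axis_rest P p) = m"
    "axis_configuration m 0 (P - {p})"
    by (rule remove_outermost_real[OF "2.prems"])
  have P: "finite P" "P \<subseteq> axes" "P \<inter> pos_imag_axis = {}"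
    using "2.prems" by (auto simp: axis_configuration_def)
  have "coaxial x p" if "x \<in> P" for x
    using that P p(1) by (auto simp: coaxial_def)
  then show ?case
    using card_NC_single_axis[OF P(1,2) p(2)] p(3) "2.IH"[OF p(4)] by simp
next
  case (3 n)
  obtain p where p: "p \<in> pos_imag_axis" "outermost P p" "card (axis_rest P p) = n"
    "axis_configuration 0 n (P - {p})"
    by (rule remove_outermost_imag[OF "3.prems"])
  have P: "finite P" "P \<subseteq> axes" "P \<inter> pos_real_axis = {}"
    using "3.prems" by (auto simp: axis_configuration_def)
  have "coaxial x p" if "x \<in> P" for x
    using that P p(1) by (auto simp: coaxial_def)
  then show ?case
    using card_NC_single_axis[OF P(1,2) p(2)] p(3) "3.IH"[OF p(4)] by simp
next
  case (4 m n)
  obtain p where p: "p \<in> pos_real_axis" "outermost P p" "card (axis_rest P p) = m"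
    "axis_configuration m (Suc n) (P - {p})"
    by (rule remove_outermost_real[OF "4.prems"])
  obtain q where q: "q \<in> pos_imag_axis" "outermost P q" "card (axis_rest P q) = n"
    "axis_configuration (Suc m) n (P - {q})"
    by (rule remove_outermost_imag[OF "4.prems"])
  have P: "finite P" "P \<subseteq> axes"
    using "4.prems" by (auto simp: axis_configuration_def)
  have "axis_configuration m n (P - {p} - {q})"
  proof -
    have "(P - {p} - {q}) \<inter> pos_real_axis = (P - {p}) \<inter> pos_real_axis"
      "(P - {p} - {q}) \<inter> pos_imag_axis = (P - {q}) \<inter> pos_imag_axis"
      using p(1) q(1) axes_disjoint by blast+
    then show ?thesis
      using p(4) q(4) by (auto simp: axis_configuration_def)
  qed
  then have IH: "int (card (NC (P - {p} - {q}))) = nc_number m n" using "4.IH" by blast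
  have "\<not> coaxial p q" using p(1) q(1) axes_disjoint by (auto simp: coaxial_def)
  then have "card (NC P) + weight m * weight n * card (NC (P - {p} - {q})) =
    weight m * card (NC (P - {p})) + weight n * card (NC (P - {q})) + card (NC (P - {p} - {q}))"
    using card_NC_two_axes[OF P p(2) q(2)] p(3) q(3) by simp
  then have "int (card (NC P)) + weight m * weight n * nc_number m n =
    weight m * nc_number m (Suc n) + weight n * nc_number (Suc m) n + nc_number m n"
    using IH "4.IH"(1)[OF p(4)] "4.IH"(2)[OF q(4)]
    by (metis of_nat_add of_nat_mult)
  then show ?case by simp
qed

section \<open>From the recurrence to the rational function\<close>

text \<open>The denominator encodes the recurrence with coefficients 2, 2, -3; the numerator
  collects the exceptions. With \<open>v 0 0 = 0\<close> the recurrence would give 4 for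
  \<open>v 1 1\<close>, whose value is 2, hence the term \<open>- 2 * fps_x * fps_y\<close>.\<close>

lemma nc_number_gf:
  fixes u :: "nat \<Rightarrow> nat \<Rightarrow> nat"
  assumes u: "\<And>m n. int (u m n) = (if m = 0 \<and> n = 0 then 0 else nc_number m n)"
  shows "bivariate_gf u * (1 - 2 * fps_x - 2 * fps_y + 3 * fps_x * fps_y) =
    fps_x + fps_y - 2 * fps_x * fps_y"
proof -
  define v where "v = (\<lambda>m n. rat_of_nat (u m n))"
  have v: "v m n = (if m = 0 \<and> n = 0 then 0 else of_int (nc_number m n))" for m n
    unfolding v_def u[symmetric] using u[of m n] by (metis of_int_0 of_int_of_nat_eq)
  define f where "f = bivariate_gf u"
  have f: "fps_nth (fps_nth f m) n = v m n" for m n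
    by (simp add: f_def bivariate_gf_def v_def)
  have v_base: "v 0 0 = 0" "v (Suc 0) 0 = 1" "v 0 (Suc 0) = 1" "v (Suc 0) (Suc 0) = 2"
    by (simp_all add: v weight_def)
  have v_real: "v (Suc (Suc m)) 0 = 2 * v (Suc m) 0" for m
    by (simp add: v weight_def)
  have v_imag: "v 0 (Suc (Suc n)) = 2 * v 0 (Suc n)" for n
    by (simp add: v weight_def)
  \<comment> \<open>The case \<open>m = n = 0\<close> is excluded because
    \<open>nc_number 0 0\<close> is 1 while \<open>v 0 0\<close> is 0.\<close>
  have v_rec: "v (Suc m) (Suc n) = of_nat (weight m) * v m (Suc n) + of_nat (weight n) * v (Suc m) n
      - of_nat (weight m * weight n) * v m n + v m n" if "m \<noteq> 0 \<or> n \<noteq> 0" for m n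
    using that by (auto simp: v)
  \<comment> \<open>For \<open>m = 0\<close> the weight is 1 instead of 2, but the doubling
    \<open>v 0 (n + 1) = 2 * v 0 n\<close> for positive \<open>n\<close> turns the relation into the
    generic one; \<open>n = 0\<close> is symmetric.\<close>
  have rec: "v (Suc m) (Suc n) = 2 * v m (Suc n) + 2 * v (Suc m) n - 3 * v m n"
    if "m \<noteq> 0 \<or> n \<noteq> 0" for m n
    using v_rec[OF that] that v_real v_imag v_base
    by (cases m; cases n) (simp_all add: weight_def)
  \<comment> \<open>Numeral multiples are spelled out as sums and products are nested, so each
    summand on the left is a shift of \<open>f\<close>.\<close>
  have "fps_nth (fps_nth (f - (fps_x * f + fps_x * f) - (fps_y * f + fps_y * f)
        + (fps_x * (fps_y * f) + fps_x * (fps_y * f) + fps_x * (fps_y * f))) m) n =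
    fps_nth (fps_nth (fps_x + fps_y - (fps_x * fps_y + fps_x * fps_y)) m) n" for m n
  proof (cases m)
    case 0
    then show ?thesis
      by (cases n; cases "n - 1") (auto simp: f v_base v_imag numeral_fps_const)
  next
    case (Suc k)
    then show ?thesis
      by (cases n; cases k; cases "n - 1") (auto simp: f v_base v_real rec numeral_fps_const)
  qed
  then have "f - (fps_x * f + fps_x * f) - (fps_y * f + fps_y * f)
        + (fps_x * (fps_y * f) + fps_x * (fps_y * f) + fps_x * (fps_y * f)) =
      fps_x + fps_y - (fps_x * fps_y + fps_x * fps_y)"
    by (simp add: fps_eq_iff)
  then show ?thesis
    by (simp add: f_def[symmetric] algebra_simps)
qed

theorem theorem3p3:
  fixes U :: "nat \<Rightarrow> nat \<Rightarrow> complex set"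
  assumes "\<And>m n. (m, n) \<noteq> (0, 0) \<Longrightarrow> axis_configuration m n (U m n)"
  shows "bivariate_gf (nc_count U) =
           (fps_x + fps_y - 2 * fps_x * fps_y) /
           (1 - 2 * fps_x - 2 * fps_y + 3 * fps_x * fps_y)"
proof -
  let ?d = "1 - 2 * fps_x - 2 * fps_y + 3 * fps_x * fps_y"
  let ?f = "fps_x + fps_y - 2 * fps_x * fps_y"
  have "int (nc_count U m n) = (if m = 0 \<and> n = 0 then 0 else nc_number m n)" for m n
    using assms[of m n] card_NC_eq_nc_number by (auto simp: nc_count_def)
  then have "bivariate_gf (nc_count U) * ?d = ?f / ?d * ?d"
    unfolding quotient_is_genuine by (rule nc_number_gf)
  \<comment> \<open>Cancelling \<open>?d\<close> requires only that it be nonzero, since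
    \<open>rat fps fps\<close> is an integral domain; its constant coefficient is 1.\<close>
  moreover have "?d \<noteq> 0"
  proof
    assume "?d = 0"
    then have "fps_nth (fps_nth ?d 0) 0 = 0" by simp
    then show False by (simp add: mult.assoc numeral_fps_const)
  qed
  ultimately show ?thesis by (metis mult_right_cancel)
qed

end
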